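(* Let $n$ be a positive integer and $p,q\in\mathbb{N}_0$ with $q\neq p+1$. Then \begin{align*} \sum_{k=1}^n\frac{(p+k)!}{(q+k)!}H_{p+k}H_{q+k} &=\left\{(p-q+1)H_{p+n+1}H_{q+n}-H_{p+n+1}-H_{q+n}+\frac{2}{p-q+1}\right\}\frac{(p+n+1)!}{(q+n)!\,(p-q+1)^2}\\ &\quad-\frac{(p+1)!}{q!\,(p-q+1)^2}\left\{(p-q+1)H_{p+1}H_{q}-H_{p+1}-H_{q}+\frac{2}{p-q+1}\right\}. \end{align*}
   Context: $H_0=0$ and $H_m=\sum_{j=1}^m \frac1j$ for $m\ge1$. *)

theory Defs
  imports "HOL-Analysis.Harmonic_Numbers"
begin

text \<open>The harmonic number \<open>H\<^sub>m\<close> is the library's \<open>harm m\<close>, with \<open>harm 0 = 0\<close>.\<close>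

end

theory Submission
  imports Defs
begin

text \<open>The sum telescopes. This is the difference of consecutive values of the antidifference, with
  \<open>a = p + k + 1\<close>, \<open>b = q + k\<close>, \<open>d = a - b\<close>, \<open>A = H\<^bsub>p+k\<^esub>\<close>, \<open>B = H\<^bsub>q+k\<^esub>\<close>,
  after division by the common factor \<open>(p+k)! / (q+k)!\<close>.\<close>

lemma antidifference_step:
  fixes a b d A B :: real
  assumes "a \<noteq> 0" "b \<noteq> 0" "d \<noteq> 0" "d = a - b"
  shows "(d * (A + 1 / a) * B - (A + 1 / a) - B + 2 / d) * (a / d\<^sup>2)
    - (d * A * (B - 1 / b) - A - (B - 1 / b) + 2 / d) * (b / d\<^sup>2) = A * B"
proof -
  \<comment> \<open>In this expansion \<open>d\<close> and \<open>a - b\<close> stay separate, so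
    that the cancellations show: once \<open>d = a - b\<close>, the terms linear in \<open>A\<close>
    and \<open>B\<close> vanish and the constants become \<open>2 - 2\<close>.\<close>
  have "a * (d * (A + 1 / a) * B - (A + 1 / a) - B + 2 / d)
      - b * (d * A * (B - 1 / b) - A - (B - 1 / b) + 2 / d)
    = d * (a - b) * (A * B) + (d - (a - b)) * (A + B) + 2 * ((a - b) / d) - 2"
    using assms(1-3) by (simp add: field_simps)
  also have "\<dots> = d\<^sup>2 * (A * B)"
    using assms(3,4) by (simp add: power2_eq_square)
  finally show ?thesis
    using assms(3) by (simp add: diff_divide_distrib[symmetric] mult.commute divide_eq_eq)
qed

theorem theorem3:
  fixes n p q :: nat
  assumes "n > 0" and "q \<noteq> p + 1"
  shows "(\<Sum>k=1..n. (fact (p + k) :: real) / fact (q + k) * harm (p + k) * harm (q + k)) =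
    ((real p - real q + 1) * harm (p + n + 1) * harm (q + n)
        - harm (p + n + 1) - harm (q + n) + 2 / (real p - real q + 1))
      * (fact (p + n + 1) / (fact (q + n) * (real p - real q + 1)\<^sup>2))
    - fact (p + 1) / (fact q * (real p - real q + 1)\<^sup>2)
      * ((real p - real q + 1) * harm (p + 1) * harm q
        - harm (p + 1) - harm q + 2 / (real p - real q + 1))"
proof -
  define d :: real where "d = real p - real q + 1"
  \<comment> \<open>The antidifference is read off the closed form, whose two terms are
    \<open>F n\<close> and \<open>F 0\<close>.\<close>
  define F where "F k = (d * harm (p + k + 1) * harm (q + k)
      - harm (p + k + 1) - harm (q + k) + 2 / d) * (fact (p + k + 1) / (fact (q + k) * d\<^sup>2))" for k
  have "d \<noteq> 0"
    using assms(2) unfolding d_def by linarith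
  have step: "(fact (p + Suc m) :: real) / fact (q + Suc m) * harm (p + Suc m) * harm (q + Suc m)
      = F (Suc m) - F m" for m
  proof -
    \<comment> \<open>The summation index is \<open>k = Suc m\<close>, so \<open>F (k - 1)\<close>
      is \<open>F m\<close> without truncated subtraction, and \<open>b = q + k\<close> is positive
      even for \<open>q = 0\<close>.\<close>
    define a b A B r :: real where "a = real p + real m + 2" and "b = real q + real m + 1"
      and "A = harm (p + Suc m)" and "B = harm (q + Suc m)"
      and "r = fact (p + Suc m) / fact (q + Suc m)"
    have pos: "a > 0" "b > 0" and d: "d = a - b"
      unfolding a_def b_def d_def by linarith+
    \<comment> \<open>Only these two harmonic numbers need shifting: \<open>F (Suc m)\<close>
      already contains \<open>B\<close>, and \<open>F m\<close> already contains
      \<open>A\<close>.\<close>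
    have harms: "harm (p + Suc m + 1) = A + 1 / a" "harm (q + m) = B - 1 / b"
      unfolding A_def B_def a_def b_def by (simp_all add: harm_Suc inverse_eq_divide add_ac)
    have "fact (p + Suc m + 1) = a * fact (p + Suc m)"
      unfolding a_def by (simp add: algebra_simps)
    then have "fact (p + Suc m + 1) / (fact (q + Suc m) * d\<^sup>2) = r * (a / d\<^sup>2)"
      unfolding r_def by simp
    moreover have "fact (q + Suc m) = b * fact (q + m)"
      unfolding b_def by (simp add: algebra_simps)
    \<comment> \<open>The numerator is already that of \<open>r\<close>, since
      \<open>p + m + 1 = p + Suc m\<close>; the factor \<open>b\<close> comes from the denominator
      alone.\<close>
    then have "fact (p + m + 1) / (fact (q + m) * d\<^sup>2) = r * (b / d\<^sup>2)"
      using pos unfolding r_def by simp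
    ultimately have "F (Suc m) - F m
      = r * ((d * (A + 1 / a) * B - (A + 1 / a) - B + 2 / d) * (a / d\<^sup>2)
        - (d * A * (B - 1 / b) - A - (B - 1 / b) + 2 / d) * (b / d\<^sup>2))"
      unfolding F_def harms by (simp add: A_def B_def algebra_simps)
    also have "\<dots> = r * (A * B)"
      using antidifference_step[of a b d A B] pos d \<open>d \<noteq> 0\<close> by simp
    finally show ?thesis
      by (simp add: r_def A_def B_def)
  qed
  have "(\<Sum>k=1..n. (fact (p + k) :: real) / fact (q + k) * harm (p + k) * harm (q + k))
      = (\<Sum>m<n. F (Suc m) - F m)"
    unfolding step[symmetric] by (simp add: sum.atLeast1_atMost_eq)
  also have "\<dots> = F n - F 0"
    by (rule sum_lessThan_telescope)
  finally show ?thesis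
    by (simp add: F_def d_def mult.commute)
qed

end
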